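(* Let $\Sigma = \{0,1,2,3\}$. There is a finite set $F \subset \mathrm{Aut}(\Sigma^{\mathbb{Z}})$ such that each element of $F$ is a commutator of two elements of $\mathrm{Aut}(\Sigma^{\mathbb{Z}})$ and is also a composition of (finitely many) involutive (i.e. order two) elements of $\mathrm{Aut}(\Sigma^{\mathbb{Z}})$, and such that if $f \in \mathrm{Aut}(\Sigma^{\mathbb{Z}})$ commutes with every $g \in F$, then $f \in \langle \sigma \rangle$.
   Context: $\Sigma^{\mathbb{Z}}$ has the product topology ($\Sigma$ discrete), and the shift is $\sigma(x)_i = x_{i+1}$. $\mathrm{Aut}(\Sigma^{\mathbb{Z}})$ is the group, under composition, of homeomorphisms $f : \Sigma^{\mathbb{Z}} \to \Sigma^{\mathbb{Z}}$ commuting with $\sigma$, and $\langle \sigma \rangle = \{\sigma^n \mid n \in \mathbb{Z}\}$. The commutator of $a,b$ is $[a,b] = a b a^{-1} b^{-1}$. *)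

theory Defs
  imports "HOL-Analysis.Analysis" "HOL-Algebra.Group"
begin

type_synonym 'a config = "int \<Rightarrow> 'a"

definition config_topology :: "'a config topology" where
  "config_topology = product_topology (\<lambda>_::int. discrete_topology (UNIV :: 'a set)) UNIV"

definition shift :: "'a config \<Rightarrow> 'a config" where
  "shift x = (\<lambda>i. x (i + 1))"

text \<open>The alphabet is the type \<open>'a\<close>.\<close>

definition Aut_shift :: "('a config \<Rightarrow> 'a config) monoid" where
  "Aut_shift =
     \<lparr>carrier = {f. homeomorphic_map config_topology config_topology f \<and> f \<circ> shift = shift \<circ> f},
      mult = (\<circ>), one = id\<rparr>"

definition commutator :: "('g, 'm) monoid_scheme \<Rightarrow> 'g \<Rightarrow> 'g \<Rightarrow> 'g" where
  "commutator G a b = a \<otimes>\<^bsub>G\<^esub> b \<otimes>\<^bsub>G\<^esub> inv\<^bsub>G\<^esub> a \<otimes>\<^bsub>G\<^esub> inv\<^bsub>G\<^esub> b"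

text \<open>Involutions have order exactly two, so the identity is not one of them.\<close>

definition involutions :: "('g, 'm) monoid_scheme \<Rightarrow> 'g set" where
  "involutions G = {t \<in> carrier G. t \<noteq> \<one>\<^bsub>G\<^esub> \<and> t \<otimes>\<^bsub>G\<^esub> t = \<one>\<^bsub>G\<^esub>}"

lemma topspace_config_topology [simp]: "topspace config_topology = UNIV"
  by (simp add: config_topology_def)

lemma Aut_shift_simps [simp]:
  "f \<in> carrier Aut_shift \<longleftrightarrow>
     homeomorphic_map config_topology config_topology f \<and> f \<circ> shift = shift \<circ> f"
  "f \<otimes>\<^bsub>Aut_shift\<^esub> g = f \<circ> g"
  "\<one>\<^bsub>Aut_shift\<^esub> = id"
  by (simp_all add: Aut_shift_def)

lemma group_Aut_shift: "group (Aut_shift :: ('a config \<Rightarrow> 'a config) monoid)"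
proof (rule groupI)
  fix f g :: "'a config \<Rightarrow> 'a config"
  assume fg: "f \<in> carrier Aut_shift" "g \<in> carrier Aut_shift"
  then have "f \<circ> g \<circ> shift = shift \<circ> (f \<circ> g)"
    by (metis Aut_shift_simps(1) comp_assoc)
  with fg show "f \<otimes>\<^bsub>Aut_shift\<^esub> g \<in> carrier Aut_shift"
    by (auto intro: homeomorphic_map_compose)
next
  fix f :: "'a config \<Rightarrow> 'a config"
  assume f: "f \<in> carrier Aut_shift"
  then obtain g where g: "homeomorphic_maps config_topology config_topology f g"
    by (auto simp: homeomorphic_map_maps)
  then have gf: "g (f x) = x" and fg: "f (g x) = x" for x
    by (auto simp: homeomorphic_maps_def)
  have "g (shift x) = shift (g x)" for x
  proof -
    have "f (shift (g x)) = shift (f (g x))"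
      using f by (simp add: fun_eq_iff)
    then show ?thesis
      by (metis fg gf)
  qed
  moreover have "homeomorphic_map config_topology config_topology g"
    using g homeomorphic_maps_map by blast
  ultimately have "g \<in> carrier Aut_shift"
    by (simp add: fun_eq_iff)
  moreover have "g \<circ> f = id"
    using gf by (simp add: fun_eq_iff)
  ultimately show "\<exists>g\<in>carrier Aut_shift. g \<otimes>\<^bsub>Aut_shift\<^esub> f = \<one>\<^bsub>Aut_shift\<^esub>"
    by auto
qed (auto simp: comp_assoc)

lemma shift_in_Aut_shift: "(shift :: 'a config \<Rightarrow> 'a config) \<in> carrier Aut_shift"
proof -
  have "homeomorphic_maps config_topology config_topology (shift :: 'a config \<Rightarrow> 'a config)
          (\<lambda>x i. x (i - 1))"
    unfolding homeomorphic_maps_def config_topology_def shift_def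
    by (auto simp: continuous_map_componentwise intro!: continuous_map_product_projection)
  then show ?thesis
    by (auto simp: homeomorphic_map_maps)
qed

end

theory Submission
  imports Defs
begin

text \<open>
  Write \<open>\<Sigma> = {0,1}\<^sup>2\<close>, so that a configuration is a pair of binary tracks, and let \<open>a\<close> shift one
  track only. For an involution \<open>s\<close>, the commutator \<open>[a, s] = (a s a\<^sup>-\<^sup>1) s\<close> is also a product of two
  involutions, so four commutators of this kind are enough. Taking for \<open>s\<close> the exchange of the
  tracks, a map \<open>f\<close> commuting with \<open>[a, s]\<close> and with \<open>\<sigma>\<close> commutes with the square of the shift of
  each single track, and continuity forces \<open>f = E \<times> F\<close>. Taking for \<open>s\<close> the addition of the
  bottom track to the top one makes \<open>E\<close> and \<open>F\<close> affine with the same linear part \<open>L\<close>. Taking for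
  \<open>s\<close> the addition of the quadratic map \<open>u \<mapsto> u \<cdot> \<sigma>(u)\<close> of the bottom track forces the finite support of
  \<open>L \<delta>\<^sub>0\<close> to be a single point, so \<open>L\<close> is a power of the shift, and kills the constant of \<open>F\<close>. The same
  gate with the tracks exchanged kills the constant of \<open>E\<close>.
\<close>

section \<open>Continuity on the space of configurations\<close>

text \<open>Continuity of \<open>g\<close> for the discrete topology on the codomain; the window may depend on \<open>x\<close>.\<close>

definition locally_determined :: "('a config \<Rightarrow> 'b) \<Rightarrow> bool" where
  "locally_determined g \<longleftrightarrow> (\<forall>x. \<exists>N::int. \<forall>y. (\<forall>j. \<bar>j\<bar> \<le> N \<longrightarrow> y j = x j) \<longrightarrow> g y = g x)"

lemma locally_determinedE:
  assumes "locally_determined g"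
  obtains N :: int where "\<And>y. (\<And>j. \<bar>j\<bar> \<le> N \<Longrightarrow> y j = x j) \<Longrightarrow> g y = g x"
  using assms unfolding locally_determined_def by metis

lemma locally_determined_map: "locally_determined g \<Longrightarrow> locally_determined (\<lambda>x. h (g x))"
  unfolding locally_determined_def by metis

lemma locally_determined_map2:
  assumes "locally_determined g" "locally_determined h"
  shows "locally_determined (\<lambda>x. k (g x) (h x))"
  unfolding locally_determined_def
proof
  fix x
  obtain M where M: "\<And>y. (\<And>j. \<bar>j\<bar> \<le> M \<Longrightarrow> y j = x j) \<Longrightarrow> g y = g x"
    using assms(1) locally_determinedE by blast
  obtain N where N: "\<And>y. (\<And>j. \<bar>j\<bar> \<le> N \<Longrightarrow> y j = x j) \<Longrightarrow> h y = h x"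
    using assms(2) locally_determinedE by blast
  show "\<exists>K. \<forall>y. (\<forall>j. \<bar>j\<bar> \<le> K \<longrightarrow> y j = x j) \<longrightarrow> k (g y) (h y) = k (g x) (h x)"
    by (rule exI[of _ "max M N"]) (metis M N max.coboundedI1 max.coboundedI2)
qed

lemma locally_determined_radius_one:
  assumes "\<And>x y. y i = x i \<Longrightarrow> y (i + 1) = x (i + 1) \<Longrightarrow> y (i - 1) = x (i - 1) \<Longrightarrow> g y = g x"
  shows "locally_determined g"
  unfolding locally_determined_def
  by (intro allI exI[of _ "\<bar>i\<bar> + 1"] impI assms) auto

text \<open>Basic open sets of the product constrain finitely many coordinates, so around each of
  their points they contain the cylinder over a window [-N, N]. Conversely, such a cylinder is
  itself basic open.\<close>

lemma continuous_map_config_discrete: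
  "continuous_map config_topology (discrete_topology UNIV) g \<longleftrightarrow> locally_determined g"
proof
  assume cont: "continuous_map config_topology (discrete_topology UNIV) g"
  show "locally_determined g"
    unfolding locally_determined_def
  proof
    fix x
    have "openin config_topology {y. g y = g x}"
      using openin_continuous_map_preimage[OF cont, of "{g x}"] by simp
    then have "\<exists>U. finite {i \<in> UNIV. U i \<noteq> topspace (discrete_topology UNIV)} \<and>
        (\<forall>i\<in>UNIV. openin (discrete_topology UNIV) (U i)) \<and>
        x \<in> Pi\<^sub>E UNIV U \<and> Pi\<^sub>E UNIV U \<subseteq> {y. g y = g x}"
      unfolding config_topology_def openin_product_topology_alt by blast
    then obtain U where U: "finite {i::int. U i \<noteq> UNIV}" "x \<in> Pi\<^sub>E UNIV U"
        "Pi\<^sub>E UNIV U \<subseteq> {y. g y = g x}"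
      by auto
    \<comment> \<open>The \<open>0\<close> keeps \<open>Max\<close> meaningful when no coordinate is
      constrained.\<close>
    define N where "N = Max (insert 0 (abs ` {i. U i \<noteq> UNIV}))"
    have N: "\<bar>j\<bar> \<le> N" if "U j \<noteq> UNIV" for j
      unfolding N_def using U(1) that by (intro Max_ge) auto
    have "g y = g x" if "\<forall>j. \<bar>j\<bar> \<le> N \<longrightarrow> y j = x j" for y
    proof -
      have "y \<in> Pi\<^sub>E UNIV U"
        unfolding PiE_UNIV_domain
      proof
        fix j
        show "y j \<in> U j"
          using that U(2) N[of j] by (cases "U j = UNIV") (auto simp: PiE_UNIV_domain Pi_iff)
      qed
      then show ?thesis
        using U(3) by auto
    qed
    then show "\<exists>N. \<forall>y. (\<forall>j. \<bar>j\<bar> \<le> N \<longrightarrow> y j = x j) \<longrightarrow> g y = g x"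
      by blast
  qed
next
  assume ld: "locally_determined g"
  have "openin config_topology {x. g x \<in> V}" for V
    unfolding config_topology_def openin_product_topology_alt
  proof
    fix x assume x: "x \<in> {x. g x \<in> V}"
    obtain N where N: "\<And>y. (\<And>j. \<bar>j\<bar> \<le> N \<Longrightarrow> y j = x j) \<Longrightarrow> g y = g x"
      using ld locally_determinedE by blast
    define U where "U j = (if \<bar>j\<bar> \<le> N then {x j} else UNIV)" for j
    have "{j. U j \<noteq> UNIV} \<subseteq> {-N..N}"
      by (auto simp: U_def)
    then have "finite {j. U j \<noteq> UNIV}"
      using finite_subset by blast
    moreover have "g y \<in> V" if "y \<in> Pi\<^sub>E UNIV U" for y
    proof -
      have "y j = x j" if "\<bar>j\<bar> \<le> N" for j
        using PiE_mem[OF \<open>y \<in> Pi\<^sub>E UNIV U\<close>, of j] that by (simp add: U_def)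
      then show ?thesis
        using N[of y] x by simp
    qed
    moreover have "x \<in> Pi\<^sub>E UNIV U"
      by (simp add: PiE_UNIV_domain U_def)
    ultimately show "\<exists>U. finite {i \<in> UNIV. U i \<noteq> topspace (discrete_topology UNIV)} \<and>
        (\<forall>i\<in>UNIV. openin (discrete_topology UNIV) (U i)) \<and>
        x \<in> Pi\<^sub>E UNIV U \<and> Pi\<^sub>E UNIV U \<subseteq> {x. g x \<in> V}"
      by (intro exI[of _ U]) auto
  qed
  then show "continuous_map config_topology (discrete_topology UNIV) g"
    by (simp add: continuous_map_def)
qed

lemma continuous_map_config:
  "continuous_map X config_topology f \<longleftrightarrow>
     (\<forall>i. continuous_map X (discrete_topology UNIV) (\<lambda>x. f x i))"
  by (subst config_topology_def) (rule continuous_map_componentwise_UNIV)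

lemma Aut_shiftI:
  assumes "\<And>i. locally_determined (\<lambda>x. f x i)" "\<And>i. locally_determined (\<lambda>x. g x i)"
    and "\<And>x. g (f x) = x" "\<And>x. f (g x) = x" "\<And>x. f (shift x) = shift (f x)"
  shows "f \<in> carrier Aut_shift"
proof -
  have "homeomorphic_maps config_topology config_topology f g"
    using assms by (simp add: homeomorphic_maps_def continuous_map_config continuous_map_config_discrete)
  then show ?thesis
    using assms(5) by (auto simp: homeomorphic_map_maps fun_eq_iff)
qed

lemma Aut_shift_locally_determined:
  assumes "f \<in> carrier Aut_shift"
  shows "locally_determined (\<lambda>x. f x i)"
proof -
  have "continuous_map config_topology config_topology f"
    using assms homeomorphic_imp_continuous_map by auto
  then show ?thesis
    by (simp add: continuous_map_config continuous_map_config_discrete)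
qed

lemma Aut_shift_inj:
  assumes "f \<in> carrier Aut_shift"
  shows "inj f"
  using assms by (auto simp: homeomorphic_eq_everything_map)

lemma inv_Aut_shift:
  assumes "f \<in> carrier Aut_shift" "g \<in> carrier Aut_shift" "\<And>x. g (f x) = x"
  shows "inv\<^bsub>Aut_shift\<^esub> f = g"
  by (rule group.inv_equality[OF group_Aut_shift _ assms(1,2)]) (simp add: assms(3) fun_eq_iff)

section \<open>Integer translations and powers of the shift\<close>

lemma commute_translate:
  fixes f :: "'a config \<Rightarrow> 'b config" and n :: int
  assumes "\<And>x. f (shift x) = shift (f x)"
  shows "f (\<lambda>i. x (i + n)) = (\<lambda>i. f x (i + n))"
proof (induction n arbitrary: x rule: int_induct[where k = 0])
  case (step1 n)
  have "f (\<lambda>i. x (i + (n + 1))) = f (\<lambda>i. shift x (i + n))"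
    by (simp add: shift_def add.assoc)
  then show ?case
    by (simp add: step1 assms) (simp add: shift_def add.assoc)
next
  case (step2 n)
  \<comment> \<open>Going down, equivariance is applied at \<open>n - 1\<close>, and the resulting
    \<open>shift\<close> is cancelled by reading at \<open>i - 1\<close>.\<close>
  have "f (\<lambda>i. x (i + n)) = shift (f (\<lambda>i. x (i + (n - 1))))"
    by (simp flip: assms) (simp add: shift_def add.assoc add.commute)
  then have "f (\<lambda>i. x (i + (n - 1))) (i + 1) = f x (i + n)" for i
    by (simp add: step2 shift_def fun_eq_iff)
  from this[of "i - 1" for i] show ?case
    by (simp add: fun_eq_iff algebra_simps)
qed simp

lemma shift_int_pow:
  "(shift [^]\<^bsub>Aut_shift\<^esub> (n::int)) x = (\<lambda>i. x (i + n))"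
proof (induction n arbitrary: x rule: int_induct[where k = 0])
  case base
  show ?case
    using int_pow_int[of Aut_shift shift 0] by (simp add: Aut_shift_def)
next
  case (step1 n)
  have "shift [^]\<^bsub>Aut_shift\<^esub> (n + 1) = (shift [^]\<^bsub>Aut_shift\<^esub> n) \<circ> (shift :: 'a config \<Rightarrow> _)"
    using group.int_pow_mult[OF group_Aut_shift shift_in_Aut_shift, of n 1]
    by (simp add: group.int_pow_1 group_Aut_shift shift_in_Aut_shift del: Aut_shift_simps(1))
  then show ?case
    by (simp add: step1) (simp add: shift_def add.assoc)
next
  case (step2 n)
  have "shift [^]\<^bsub>Aut_shift\<^esub> n = (shift [^]\<^bsub>Aut_shift\<^esub> (n - 1)) \<circ> (shift :: 'a config \<Rightarrow> _)"
    using group.int_pow_mult[OF group_Aut_shift shift_in_Aut_shift, of "n - 1" 1]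
    by (simp add: group.int_pow_1 group_Aut_shift shift_in_Aut_shift del: Aut_shift_simps(1))
  \<comment> \<open>The argument is the preimage of \<open>x\<close> under \<open>shift\<close>, so
    the right-hand side becomes the power \<open>n - 1\<close> applied to \<open>x\<close>.\<close>
  from fun_cong[OF this, of "\<lambda>i. x (i - 1)"]
  have "(shift [^]\<^bsub>Aut_shift\<^esub> (n - 1)) (shift (\<lambda>i. x (i - 1))) = (\<lambda>i. x (i + n - 1))"
    by (simp add: step2)
  then show ?case
    by (simp add: shift_def[of "\<lambda>i. x (i - 1)"] algebra_simps)
qed

text \<open>A block of \<open>x\<close> on a constant background takes the value \<open>g x\<close>, and far translates of it
  look constant near the origin.\<close>

lemma translation_invariant_constant:
  fixes g :: "'a config \<Rightarrow> 'b" and k :: nat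
  assumes ld: "locally_determined g" and inv: "\<And>x. g (\<lambda>i. x (i + int k)) = g x" and "k > 0"
  shows "g x = g y"
proof -
  have inv_iter: "g (\<lambda>i. x (i + int n * int k)) = g x" for n x
  proof (induction n arbitrary: x)
    case (Suc n)
    show ?case
      using Suc[of "\<lambda>i. x (i + int k)"] inv[of x] by (simp add: algebra_simps)
  qed simp
  fix c :: 'a
  have "g x = g (\<lambda>_. c)" for x
  proof -
    obtain M where M: "\<And>z. (\<And>j. \<bar>j\<bar> \<le> M \<Longrightarrow> z j = x j) \<Longrightarrow> g z = g x"
      using ld locally_determinedE by blast
    obtain N where N: "\<And>z. (\<And>j. \<bar>j\<bar> \<le> N \<Longrightarrow> z j = c) \<Longrightarrow> g z = g (\<lambda>_. c)"
      using ld locally_determinedE[of g "\<lambda>_. c"] by metis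
    define z where "z i = (if \<bar>i\<bar> \<le> M then x i else c)" for i
    \<comment> \<open>As \<open>k\<close> is at least 1, this many translations carry the block of
      radius \<open>M\<close> out of the window of radius \<open>N\<close>; the absolute values
      cover negative radii.\<close>
    define n where "n = nat (\<bar>M\<bar> + \<bar>N\<bar> + 1)"
    have far: "int n * int k \<ge> \<bar>M\<bar> + \<bar>N\<bar> + 1"
      using \<open>k > 0\<close> mult_left_mono[of 1 "int k" "int n"] by (simp add: n_def)
    have "g x = g z"
      using M[of z] by (simp add: z_def)
    also have "\<dots> = g (\<lambda>i. z (i + int n * int k))"
      using inv_iter by simp
    also have "\<dots> = g (\<lambda>_. c)"
    proof (rule N)
      fix j :: int
      assume "\<bar>j\<bar> \<le> N"
      then have "\<bar>j + int n * int k\<bar> > M"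
        using far by linarith
      then show "z (j + int n * int k) = c"
        by (simp add: z_def)
    qed
    finally show ?thesis .
  qed
  then show ?thesis
    by metis
qed

lemma shift_invariant_constant:
  assumes "locally_determined g" "\<And>x. g (shift x) = g x"
  shows "g x = g y"
  using translation_invariant_constant[of g 1] assms by (simp add: shift_def)

section \<open>Binary configurations\<close>

text \<open>Bits are booleans, with \<open>\<noteq>\<close> as addition modulo 2 and \<open>\<and>\<close> as multiplication.\<close>

definition addc :: "bool config \<Rightarrow> bool config \<Rightarrow> bool config" (infixl "\<boxplus>" 65) where
  "u \<boxplus> v = (\<lambda>i. u i \<noteq> v i)"

definition diffc :: "bool config \<Rightarrow> bool config" where
  "diffc u = (\<lambda>i. u (i + 1) \<noteq> u i)"

definition quadc :: "bool config \<Rightarrow> bool config" where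
  "quadc u = (\<lambda>i. u i \<and> u (i + 1))"

definition point :: "int \<Rightarrow> bool config" where
  "point k = (\<lambda>i. i = k)"

text \<open>Summation modulo 2 from the origin inverts \<open>diffc\<close>. Hence gates that only
  add differences still control the addition of arbitrary sequences.\<close>

lemma diffc_surj: "\<exists>u. diffc u = v"
proof -
  \<comment> \<open>The discrete integral of \<open>v\<close> vanishing at 0: it runs over [0, i) to
    the right and over [i, 0) to the left, where the sign disappears modulo 2.\<close>
  define u where "u i = odd (card {j. v j \<and> (0 \<le> j \<and> j < i \<or> i \<le> j \<and> j < 0)})" for i
  have "u (i + 1) \<longleftrightarrow> (u i \<noteq> v i)" for i
  proof (cases "i \<ge> 0")
    case True
    have "{j. v j \<and> (0 \<le> j \<and> j < i + 1 \<or> i + 1 \<le> j \<and> j < 0)} =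
        (if v i then insert i else id) {j. v j \<and> (0 \<le> j \<and> j < i)}"
      using True by (auto simp: less_le)
    moreover have "{j. v j \<and> (0 \<le> j \<and> j < i \<or> i \<le> j \<and> j < 0)} = {j. v j \<and> (0 \<le> j \<and> j < i)}"
      using True by auto
    moreover have "finite {j. v j \<and> (0 \<le> j \<and> j < i)}"
      by (rule finite_subset[of _ "{0..<i}"]) auto
    ultimately show ?thesis
      by (simp add: u_def)
  next
    case False
    have "{j. v j \<and> (0 \<le> j \<and> j < i \<or> i \<le> j \<and> j < 0)} =
        (if v i then insert i else id) {j. v j \<and> (i + 1 \<le> j \<and> j < 0)}"
      using False by (auto simp: order.order_iff_strict)
    moreover have "{j. v j \<and> (0 \<le> j \<and> j < i + 1 \<or> i + 1 \<le> j \<and> j < 0)} =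
        {j. v j \<and> (i + 1 \<le> j \<and> j < 0)}"
      using False by auto
    moreover have "finite {j. v j \<and> (i + 1 \<le> j \<and> j < 0)}"
      by (rule finite_subset[of _ "{i..<0}"]) auto
    ultimately show ?thesis
      by (simp add: u_def)
  qed
  then have "diffc u = v"
    by (auto simp: diffc_def fun_eq_iff)
  then show ?thesis by blast
qed

text \<open>The kernel of \<open>diffc\<close> consists of the two constant sequences.\<close>

lemma diffc_eq_imp_const:
  assumes "diffc u = diffc v"
  shows "(u i \<noteq> v i) = (u 0 \<noteq> v 0)"
proof -
  have step: "(u (i + 1) \<noteq> v (i + 1)) = (u i \<noteq> v i)" for i
    using fun_cong[OF assms, of i] by (auto simp: diffc_def)
  show ?thesis
  proof (induction i rule: int_induct[where k = 0])
    case (step2 i)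
    then show ?case
      using step[of "i - 1"] by simp
  qed (use step in auto)
qed

text \<open>Additivity settles finitely supported sequences; these suffice because each output bit
  sees only a finite window.\<close>

lemma additive_eq_translate:
  fixes L :: "bool config \<Rightarrow> bool config"
  assumes add: "\<And>u v. L (u \<boxplus> v) = L u \<boxplus> L v"
    and ld: "\<And>i. locally_determined (\<lambda>u. L u i)"
    and pt: "\<And>k i. L (point k) i \<longleftrightarrow> i + n = k"
  shows "L u i = u (i + n)"
proof -
  have L0: "L (\<lambda>_. False) = (\<lambda>_. False)"
    using add[of "\<lambda>_. False" "\<lambda>_. False"] by (simp add: addc_def)
  have fin: "finite A \<Longrightarrow> L (\<lambda>i. i \<in> A) i = (i + n \<in> A)" for A
  proof (induction A rule: finite_induct)
    case (insert k A)
    have "(\<lambda>i. i \<in> insert k A) = point k \<boxplus> (\<lambda>i. i \<in> A)"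
      using insert by (auto simp: addc_def point_def)
    then show ?case
      using insert by (simp add: add) (auto simp: pt addc_def)
  qed (simp add: L0)
  obtain N where N: "\<And>v. (\<And>j. \<bar>j\<bar> \<le> N \<Longrightarrow> v j = u j) \<Longrightarrow> L v i = L u i"
    using locally_determinedE[OF ld, of u i] by metis
  \<comment> \<open>The truncation must agree with \<open>u\<close> on the window of radius
    \<open>N\<close> and also at the target cell \<open>i + n\<close>.\<close>
  define A where "A = {j. u j \<and> \<bar>j\<bar> \<le> max N \<bar>i + n\<bar>}"
  have "finite A"
    unfolding A_def by (rule finite_subset[of _ "{-(max N \<bar>i + n\<bar>)..max N \<bar>i + n\<bar>}"]) auto
  have "L u i = L (\<lambda>i. i \<in> A) i"
    by (rule N[symmetric]) (auto simp: A_def)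
  also have "\<dots> = u (i + n)"
    using fin[OF \<open>finite A\<close>] by (simp add: A_def)
  finally show ?thesis .
qed

text \<open>The last two hypotheses say that \<open>E \<times> F\<close> commutes with two gates that add a function of the
  bottom track to the top track. If \<open>m < M\<close> are the ends of the support of \<open>p = L \<delta>\<^sub>0\<close>, then
  \<open>\<delta>\<^sub>0 \<boxplus> \<delta>\<^sub>k\<close> with \<open>k = M - m + 1 \<ge> 2\<close> has no two adjacent ones, but its image under \<open>L\<close>
  does, at \<open>M\<close> and \<open>M + 1\<close>.\<close>

lemma translate_up_to_flip:
  fixes E F :: "bool config \<Rightarrow> bool config"
  assumes ldE: "\<And>i. locally_determined (\<lambda>u. E u i)"
    and ldF: "\<And>i. locally_determined (\<lambda>u. F u i)"
    and shE: "\<And>u. E (shift u) = shift (E u)"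
    and shF: "\<And>u. F (shift u) = shift (F u)"
    and "inj E"
    and lin: "\<And>u v. E (u \<boxplus> diffc v) = E u \<boxplus> diffc (F v)"
    and quad: "\<And>u v. E (u \<boxplus> diffc (quadc v)) = E u \<boxplus> diffc (quadc (F v))"
  obtains n c where "\<And>u i. E u i = (u (i + n) \<noteq> c)" "\<And>u i. F u i = u (i + n)"
proof -
  define z :: "bool config" where "z = (\<lambda>_. False)"
  have z_add [simp]: "z \<boxplus> u = u" "u \<boxplus> z = u" for u
    by (simp_all add: z_def addc_def)
  \<comment> \<open>\<open>z\<close> is fixed by every translation, so \<open>E z\<close> is
    constant.\<close>
  have E0: "E z i = E z 0" for i
    using commute_translate[of E z i] shE by (simp add: z_def fun_eq_iff) (metis add_0)
  define L where "L u = E u \<boxplus> E z" for u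
  \<comment> \<open>Writing \<open>v\<close> as a difference, \<open>lin\<close> shows that adding
    \<open>v\<close> changes \<open>E u\<close> and \<open>E z\<close> by the same sequence.\<close>
  have L_add: "L (u \<boxplus> v) = L u \<boxplus> L v" for u v
  proof -
    obtain w where "diffc w = v"
      using diffc_surj by blast
    then have "E (u \<boxplus> v) = E u \<boxplus> diffc (F w)" "E v = E z \<boxplus> diffc (F w)"
      using lin[of u w] lin[of z w] by auto
    then show ?thesis
      by (auto simp: L_def addc_def)
  qed
  have L_shift: "L (shift u) = shift (L u)" for u
    unfolding L_def shE using E0 by (simp add: addc_def shift_def fun_eq_iff) metis
  have L_diffc: "L (diffc u) = diffc (L u)" for u
  proof -
    have "diffc u = shift u \<boxplus> u" for u
      by (simp add: diffc_def addc_def shift_def)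
    then show ?thesis
      by (simp add: L_add L_shift)
  qed
  have ldL: "locally_determined (\<lambda>u. L u i)" for i
    unfolding L_def addc_def by (rule locally_determined_map[OF ldE])
  have L0: "L z = z"
    by (auto simp: L_def z_def addc_def)
  define e where "e = F z 0"
  \<comment> \<open>\<open>F u\<close> and \<open>L u\<close> have equal differences, so they differ
    by one bit \<open>g u\<close>. This bit is local and shift-invariant, hence independent of
    \<open>u\<close>.\<close>
  have F_L: "F u i = (L u i \<noteq> e)" for u i
  proof -
    have dc: "diffc (F u) = diffc (L u)" for u
      using lin[of z u] by (simp flip: L_diffc) (auto simp: L_def addc_def)
    define g where "g u = (F u 0 \<noteq> L u 0)" for u
    have "g u = g z"
    proof (rule shift_invariant_constant[of g])
      show "locally_determined g"
        unfolding g_def by (rule locally_determined_map2[OF ldF ldL])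
      show "g (shift u) = g u" for u
        using diffc_eq_imp_const[OF dc, of u 1] by (simp add: g_def shF L_shift) (simp add: shift_def)
    qed
    moreover have "g z = e"
      unfolding g_def e_def L0 by (simp add: z_def)
    ultimately show ?thesis
      using diffc_eq_imp_const[OF dc, of u i] unfolding g_def by blast
  qed
  \<comment> \<open>The same argument for the quadratic gate. The bit is again \<open>e\<close>: at
    \<open>z\<close> it is the product of \<open>e\<close> with itself.\<close>
  have L_quadc: "L (quadc u) i = (quadc (F u) i \<noteq> e)" for u i
  proof -
    have dc: "diffc (L (quadc u)) = diffc (quadc (F u))" for u
      using quad[of z u] by (simp flip: L_diffc) (auto simp: L_def addc_def)
    define g where "g u = (L (quadc u) 0 \<noteq> quadc (F u) 0)" for u
    have quadc_shift: "quadc (shift u) = shift (quadc u)" for u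
      by (simp add: quadc_def shift_def)
    have "g u = g z"
    proof (rule shift_invariant_constant[of g])
      have E_quadc: "locally_determined (\<lambda>u. L (quadc u) 0)"
        unfolding locally_determined_def
      proof
        fix x
        obtain N where N: "\<And>y. (\<And>j. \<bar>j\<bar> \<le> N \<Longrightarrow> y j = quadc x j) \<Longrightarrow> L y 0 = L (quadc x) 0"
          using locally_determinedE[OF ldL, of "quadc x" 0] by metis
        \<comment> \<open>The radius grows by one because \<open>quadc\<close> also reads the cell
          to the right.\<close>
        have "L (quadc y) 0 = L (quadc x) 0" if "\<forall>j. \<bar>j\<bar> \<le> N + 1 \<longrightarrow> y j = x j" for y
          by (rule N) (use that in \<open>simp add: quadc_def\<close>)
        then show "\<exists>N. \<forall>y. (\<forall>j. \<bar>j\<bar> \<le> N \<longrightarrow> y j = x j) \<longrightarrow> L (quadc y) 0 = L (quadc x) 0"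
          by blast
      qed
      have "locally_determined (\<lambda>u. quadc (F u) 0)"
        unfolding quadc_def by (rule locally_determined_map2[OF ldF ldF])
      from locally_determined_map2[OF E_quadc this] show "locally_determined g"
        unfolding g_def .
      show "g (shift u) = g u" for u
        using diffc_eq_imp_const[OF dc, of u 1]
        by (simp add: g_def shF L_shift quadc_shift) (simp add: shift_def)
    qed
    moreover have "g z = e"
    proof -
      have "quadc z = z"
        by (simp add: quadc_def z_def)
      then show ?thesis
        by (auto simp: g_def L0 F_L quadc_def) (auto simp: z_def)
    qed
    ultimately show ?thesis
      using diffc_eq_imp_const[OF dc, of u i] unfolding g_def by blast
  qed
  define p where "p = L (point 0)"
  have L_point: "L (point k) i = p (i - k)" for k i
  proof -
    have "point k = (\<lambda>i. point 0 (i + (- k)))"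
      by (auto simp: point_def)
    then show ?thesis
      using commute_translate[of L "point 0" "-k"] by (simp add: L_shift p_def)
  qed
  obtain N where N: "\<And>v. (\<And>j. \<bar>j\<bar> \<le> N \<Longrightarrow> v j = z j) \<Longrightarrow> L v 0 = L z 0"
    using locally_determinedE[OF ldL, of z 0] by metis
  \<comment> \<open>\<open>p i\<close> is the bit at 0 of the image of \<open>point (- i)\<close>,
    which looks like \<open>z\<close> on the window.\<close>
  have p_zero: "\<not> p i" if "\<bar>i\<bar> > N" for i
  proof -
    have "L (point (- i)) 0 = L z 0"
      by (rule N) (use that in \<open>auto simp: z_def point_def\<close>)
    then show ?thesis
      by (simp add: L_point L0) (simp add: z_def)
  qed
  have finp: "finite {i. p i}"
    by (rule finite_subset[of _ "{-N..N}"]) (use p_zero in force)+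
  \<comment> \<open>Otherwise \<open>E\<close> would identify \<open>point 0\<close> with
    \<open>z\<close>.\<close>
  have "\<exists>i. p i"
  proof (rule ccontr)
    assume "\<not> (\<exists>i. p i)"
    then have "E (point 0) = E z"
      by (auto simp: p_def L_def addc_def)
    then show False
      using \<open>inj E\<close> by (auto simp: inj_def z_def point_def fun_eq_iff)
  qed
  define M where "M = Max {i. p i}"
  define m where "m = Min {i. p i}"
  have pM: "p M" and pm: "p m"
    using Max_in[OF finp] Min_in[OF finp] \<open>\<exists>i. p i\<close> by (auto simp: M_def m_def)
  have above: "\<not> p i" if "i > M" for i
    using Max_ge[OF finp, of i] that by (auto simp: M_def)
  have below: "\<not> p i" if "i < m" for i
    using Min_le[OF finp, of i] that by (auto simp: m_def)
  have "m = M"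
  proof (rule ccontr)
    assume "m \<noteq> M"
    then have "m < M"
      using below[of M] pM by (meson linorder_less_linear)
    define k where "k = M - m + 1"
    define b where "b = point 0 \<boxplus> point k"
    have "quadc b = z"
      using \<open>m < M\<close> by (auto simp: quadc_def b_def addc_def point_def z_def k_def)
    then have "quadc (F b) M = e"
      using L_quadc[of b M] by (simp add: L0) (auto simp: z_def)
    moreover have "F b i = ((p i \<noteq> p (i - k)) \<noteq> e)" for i
      by (simp add: F_L b_def L_add) (simp add: addc_def L_point)
    \<comment> \<open>At \<open>M\<close> only the first copy of \<open>p\<close> contributes, at
      \<open>M + 1\<close> only the second. Both bits of \<open>F b\<close> are thus the negation of
      \<open>e\<close>, and so is their product, which should equal \<open>e\<close>.\<close>
    ultimately show False
      using pM pm above[of "M + 1"] below[of "m - 1"] by (auto simp: quadc_def k_def)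
  qed
  have p_iff: "p i \<longleftrightarrow> i = M" for i
    using above[of i] below[of i] pM \<open>m = M\<close> by (metis linorder_less_linear)
  \<comment> \<open>\<open>F (point 0)\<close> has the negation of \<open>e\<close> at
    \<open>M\<close> and \<open>e\<close> at \<open>M + 1\<close>; their product is 0 but must equal
    \<open>e\<close>.\<close>
  have "\<not> e"
  proof -
    have "quadc (point 0) = z"
      by (auto simp: quadc_def point_def z_def)
    then have "quadc (F (point 0)) M = e"
      using L_quadc[of "point 0" M] by (simp add: L0) (auto simp: z_def)
    then show ?thesis
      by (auto simp: quadc_def F_L L_point p_iff)
  qed
  have L: "L u i = u (i + (- M))" for u i
    by (rule additive_eq_translate[OF L_add ldL]) (auto simp: L_point p_iff)
  show thesis
  proof
    show "E u i = (u (i + (- M)) \<noteq> E z 0)" for u i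
      using L[of u i] E0[of i] by (auto simp: L_def addc_def)
    show "F u i = u (i + (- M))" for u i
      using L[of u i] \<open>\<not> e\<close> by (simp add: F_L)
  qed
qed

text \<open>Test on \<open>point 0\<close>, where \<open>quadc\<close> vanishes. Around
  \<open>- n\<close> its image under \<open>E\<close> reads: negation of \<open>c\<close>, then
  \<open>c\<close>, \<open>c\<close>. So the difference of \<open>quadc\<close> at
  \<open>- n\<close> is \<open>c\<close>, while the left-hand side forces it to be 0.\<close>

lemma translate_if_quadratic:
  fixes E F :: "bool config \<Rightarrow> bool config"
  assumes E: "\<And>u i. E u i = (u (i + n) \<noteq> c)" and F: "\<And>u i. F u i = u (i + n)"
    and quad: "\<And>u v. F (v \<boxplus> diffc (quadc u)) = F v \<boxplus> diffc (quadc (E u))"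
  shows "E u = F u"
proof -
  have "F (point 0 \<boxplus> diffc (quadc (point 0))) (- n) = (F (point 0) \<boxplus> diffc (quadc (E (point 0)))) (- n)"
    by (simp only: quad)
  then have "\<not> c"
    by (simp add: E F addc_def diffc_def quadc_def point_def)
  then show ?thesis
    by (simp add: E F fun_eq_iff)
qed

section \<open>Two-track automorphisms\<close>

locale two_tracks =
  fixes enc :: "'a \<Rightarrow> bool \<times> bool"
  assumes bij_enc: "bij enc"
begin

definition top_track :: "'a config \<Rightarrow> bool config" where
  "top_track x = (\<lambda>i. fst (enc (x i)))"

definition bot_track :: "'a config \<Rightarrow> bool config" where
  "bot_track x = (\<lambda>i. snd (enc (x i)))"

definition join :: "bool config \<Rightarrow> bool config \<Rightarrow> 'a config" where
  "join u v = (\<lambda>i. inv_into UNIV enc (u i, v i))"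

lemma top_join [simp]: "top_track (join u v) = u"
  and bot_join [simp]: "bot_track (join u v) = v"
  and join_tracks [simp]: "join (top_track x) (bot_track x) = x"
  using bij_enc
  by (simp_all add: top_track_def bot_track_def join_def bij_is_surj surj_f_inv_f bij_is_inj)

lemma join_eq_iff [simp]: "join u v = join u' v' \<longleftrightarrow> u = u' \<and> v = v'"
  by (metis top_join bot_join)

lemma shift_join [simp]: "shift (join u v) = join (shift u) (shift v)"
  by (simp add: shift_def join_def)

lemma top_shift [simp]: "top_track (shift x) = shift (top_track x)"
  and bot_shift [simp]: "bot_track (shift x) = shift (bot_track x)"
  by (simp_all add: shift_def top_track_def bot_track_def)

definition track_map :: "(bool config \<Rightarrow> bool config \<Rightarrow> bool config) \<Rightarrow>
    (bool config \<Rightarrow> bool config \<Rightarrow> bool config) \<Rightarrow> 'a config \<Rightarrow> 'a config" where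
  "track_map f g x = join (f (top_track x) (bot_track x)) (g (top_track x) (bot_track x))"

lemma track_map_join [simp]: "track_map f g (join u v) = join (f u v) (g u v)"
  by (simp add: track_map_def)

text \<open>A common neighbourhood for all gates and their inverses, so that continuity reduces to a
  pointwise check.\<close>

definition radius_one :: "(bool config \<Rightarrow> bool config \<Rightarrow> bool config) \<Rightarrow> bool" where
  "radius_one f \<longleftrightarrow> (\<forall>i u v u' v'. (\<forall>j\<in>{i - 1, i, i + 1}. u' j = u j \<and> v' j = v j) \<longrightarrow>
     f u' v' i = f u v i)"

lemma locally_determined_track_map:
  assumes "radius_one f" "radius_one g"
  shows "locally_determined (\<lambda>x. track_map f g x i)"
proof (rule locally_determined_radius_one[where i = i])
  fix x y :: "'a config"
  assume "y i = x i" "y (i + 1) = x (i + 1)" "y (i - 1) = x (i - 1)"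
  then have "\<forall>j\<in>{i - 1, i, i + 1}. top_track y j = top_track x j \<and> bot_track y j = bot_track x j"
    by (simp add: top_track_def bot_track_def)
  then have "f (top_track y) (bot_track y) i = f (top_track x) (bot_track x) i"
      "g (top_track y) (bot_track y) i = g (top_track x) (bot_track x) i"
    using assms unfolding radius_one_def by metis+
  then show "track_map f g y i = track_map f g x i"
    by (simp add: track_map_def join_def)
qed

lemma track_map_Aut_shift:
  assumes "radius_one f" "radius_one g" "radius_one f'" "radius_one g'"
    and "\<And>u v. f' (f u v) (g u v) = u" "\<And>u v. g' (f u v) (g u v) = v"
    and "\<And>u v. f (f' u v) (g' u v) = u" "\<And>u v. g (f' u v) (g' u v) = v"
    and "\<And>u v. f (shift u) (shift v) = shift (f u v)" "\<And>u v. g (shift u) (shift v) = shift (g u v)"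
  shows "track_map f g \<in> carrier Aut_shift"
proof (rule Aut_shiftI)
  show "track_map f' g' (track_map f g x) = x" "track_map f g (track_map f' g' x) = x" for x
    using assms by (simp_all add: track_map_def)
  show "track_map f g (shift x) = shift (track_map f g x)" for x
    using assms by (simp add: track_map_def)
qed (use assms locally_determined_track_map in auto)

definition "shift_top = track_map (\<lambda>u v. shift u) (\<lambda>u v. v)"
definition "unshift_top = track_map (\<lambda>u v i. u (i - 1)) (\<lambda>u v. v)"
definition "shift_bot = track_map (\<lambda>u v. u) (\<lambda>u v. shift v)"
definition "unshift_bot = track_map (\<lambda>u v. u) (\<lambda>u v i. v (i - 1))"
definition "swap = track_map (\<lambda>u v. v) (\<lambda>u v. u)"
definition "add_top \<phi> = track_map (\<lambda>u v. u \<boxplus> \<phi> v) (\<lambda>u v. v)"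
definition "add_bot \<phi> = track_map (\<lambda>u v. u) (\<lambda>u v. v \<boxplus> \<phi> u)"

lemmas gate_defs = shift_top_def unshift_top_def shift_bot_def unshift_bot_def swap_def
  add_top_def add_bot_def

lemma shift_gates_Aut_shift:
  "shift_top \<in> carrier Aut_shift" "unshift_top \<in> carrier Aut_shift"
  "shift_bot \<in> carrier Aut_shift" "unshift_bot \<in> carrier Aut_shift"
  unfolding gate_defs
  \<comment> \<open>The four instances propose the left and right shifts of either track as inverse;
    backtracking picks the one that fits.\<close>
  by (rule track_map_Aut_shift[where f' = "\<lambda>u v i. u (i - 1)" and g' = "\<lambda>u v. v"]
        track_map_Aut_shift[where f' = "\<lambda>u v. shift u" and g' = "\<lambda>u v. v"]
        track_map_Aut_shift[where f' = "\<lambda>u v. u" and g' = "\<lambda>u v i. v (i - 1)"]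
        track_map_Aut_shift[where f' = "\<lambda>u v. u" and g' = "\<lambda>u v. shift v"];
      simp add: radius_one_def shift_def)+

lemma inv_shift_gates:
  "inv\<^bsub>Aut_shift\<^esub> shift_top = unshift_top" "inv\<^bsub>Aut_shift\<^esub> shift_bot = unshift_bot"
  by (intro inv_Aut_shift shift_gates_Aut_shift;
      simp add: gate_defs track_map_def shift_def)+

lemma involutionsI:
  assumes "t \<in> carrier Aut_shift" "\<And>x. t (t x) = x" "t y \<noteq> y"
  shows "t \<in> involutions Aut_shift"
  using assms by (auto simp: involutions_def fun_eq_iff)

lemma swap_involution: "swap \<in> involutions Aut_shift"
proof (rule involutionsI)
  show "swap \<in> carrier Aut_shift"
    unfolding swap_def
    by (rule track_map_Aut_shift[where f' = "\<lambda>u v. v" and g' = "\<lambda>u v. u"]; simp add: radius_one_def)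
  show "swap (swap x) = x" for x
    by (simp add: swap_def track_map_def)
  show "swap (join (\<lambda>_. True) (\<lambda>_. False)) \<noteq> join (\<lambda>_. True) (\<lambda>_. False)"
    by (simp add: swap_def) (metis (full_types))
qed

lemma add_involution:
  assumes "\<phi> = id \<or> \<phi> = quadc"
  shows "add_top \<phi> \<in> involutions Aut_shift" "add_bot \<phi> \<in> involutions Aut_shift"
proof -
  have radius: "radius_one (\<lambda>u v. u \<boxplus> \<phi> v)" "radius_one (\<lambda>u v. v \<boxplus> \<phi> u)"
    using assms by (elim disjE; simp add: radius_one_def addc_def quadc_def)+
  have radius': "radius_one (\<lambda>u v. u)" "radius_one (\<lambda>u v. v)"
    by (simp_all add: radius_one_def)
  have cancel: "u \<boxplus> v \<boxplus> v = u" for u v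
    by (auto simp: addc_def)
  have sh: "shift u \<boxplus> \<phi> (shift v) = shift (u \<boxplus> \<phi> v)" for u v
    using assms by (auto simp: addc_def quadc_def shift_def)
  \<comment> \<open>Both choices of \<open>\<phi>\<close> fix the all-ones sequence, so the all-ones
    configuration is moved and the gate is not the identity.\<close>
  have one: "\<phi> (\<lambda>_. True) = (\<lambda>_. True)"
    using assms by (auto simp: quadc_def)
  show "add_top \<phi> \<in> involutions Aut_shift"
  proof (rule involutionsI)
    show "add_top \<phi> \<in> carrier Aut_shift"
      unfolding add_top_def
      by (rule track_map_Aut_shift[OF radius(1) radius'(2) radius(1) radius'(2)]; simp add: cancel sh)
    show "add_top \<phi> (add_top \<phi> x) = x" for x
      by (simp add: add_top_def track_map_def cancel)
    show "add_top \<phi> (join (\<lambda>_. True) (\<lambda>_. True)) \<noteq> join (\<lambda>_. True) (\<lambda>_. True)"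
      by (simp add: add_top_def one addc_def) metis
  qed
  show "add_bot \<phi> \<in> involutions Aut_shift"
  proof (rule involutionsI)
    show "add_bot \<phi> \<in> carrier Aut_shift"
      unfolding add_bot_def
      by (rule track_map_Aut_shift[OF radius'(1) radius(2) radius'(1) radius(2)]; simp add: cancel sh)
    show "add_bot \<phi> (add_bot \<phi> x) = x" for x
      by (simp add: add_bot_def track_map_def cancel)
    show "add_bot \<phi> (join (\<lambda>_. True) (\<lambda>_. True)) \<noteq> join (\<lambda>_. True) (\<lambda>_. True)"
      by (simp add: add_bot_def one addc_def) metis
  qed
qed

end

text \<open>As \<open>s\<close> is its own inverse, the commutator is a conjugate of
  \<open>s\<close> times \<open>s\<close>, and conjugation preserves order two.\<close>

lemma (in group) commutator_involution:
  assumes a: "a \<in> carrier G" and s: "s \<in> involutions G"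
  shows "commutator G a s = a \<otimes> s \<otimes> inv a \<otimes> s"
    and "a \<otimes> s \<otimes> inv a \<in> involutions G"
proof -
  have sG: "s \<in> carrier G" and "s \<noteq> \<one>" and ss: "s \<otimes> s = \<one>"
    using s by (auto simp: involutions_def)
  then show "commutator G a s = a \<otimes> s \<otimes> inv a \<otimes> s"
    by (simp add: commutator_def inv_equality)
  have "a \<otimes> s \<otimes> inv a \<noteq> \<one>"
  proof
    assume "a \<otimes> s \<otimes> inv a = \<one>"
    then have "a \<otimes> s = a"
      using a sG by (metis inv_closed inv_equality inv_inv m_closed)
    then show False
      using a sG \<open>s \<noteq> \<one>\<close> by (simp add: l_cancel_one)
  qed
  moreover have "(a \<otimes> s \<otimes> inv a) \<otimes> (a \<otimes> s \<otimes> inv a) = a \<otimes> (s \<otimes> s) \<otimes> inv a"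
    using a sG by (simp add: m_assoc) (simp flip: m_assoc)
  ultimately show "a \<otimes> s \<otimes> inv a \<in> involutions G"
    using a sG by (simp add: involutions_def ss)
qed

section \<open>The four gates and their action on the tracks\<close>

context two_tracks
begin

definition gates :: "('a config \<Rightarrow> 'a config) set" where
  "gates = {commutator Aut_shift shift_top swap, commutator Aut_shift shift_top (add_top id),
     commutator Aut_shift shift_top (add_top quadc), commutator Aut_shift shift_bot (add_bot quadc)}"

lemma gates_form:
  assumes "g \<in> gates"
  shows "\<exists>a\<in>carrier Aut_shift. \<exists>s\<in>involutions Aut_shift. g = commutator Aut_shift a s"
  using assms shift_gates_Aut_shift swap_involution add_involution
  unfolding gates_def by blast

text \<open>Conjugating \<open>unshift_top\<close> by \<open>swap\<close> moves the inverse shift to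
  the bottom track, leaving \<open>shift_top\<close> on the top one.\<close>

lemma gate_swap:
  "commutator Aut_shift shift_top swap (join u v) = join (shift u) (\<lambda>i. v (i - 1))"
  by (subst group.commutator_involution(1)[OF group_Aut_shift shift_gates_Aut_shift(1) swap_involution])
    (simp add: inv_shift_gates, simp add: gate_defs)

text \<open>The conjugate by \<open>shift_top\<close> adds the shift of \<open>\<phi> v\<close> and
  the second factor adds \<open>\<phi> v\<close>; the sum is the difference sequence.\<close>

lemma gate_add_top:
  assumes "\<phi> = id \<or> \<phi> = quadc"
  shows "commutator Aut_shift shift_top (add_top \<phi>) (join u v) = join (u \<boxplus> diffc (\<phi> v)) v"
proof -
  have "commutator Aut_shift shift_top (add_top \<phi>) (join u v) =
      join (shift ((\<lambda>i. (u \<boxplus> \<phi> v) (i - 1)) \<boxplus> \<phi> v)) v"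
    by (subst group.commutator_involution(1)[OF group_Aut_shift shift_gates_Aut_shift(1) add_involution(1)[OF assms]])
      (simp add: inv_shift_gates, simp add: gate_defs)
  also have "shift ((\<lambda>i. (u \<boxplus> \<phi> v) (i - 1)) \<boxplus> \<phi> v) = u \<boxplus> diffc (\<phi> v)"
    by (auto simp: shift_def addc_def diffc_def)
  finally show ?thesis .
qed

lemma gate_add_bot:
  assumes "\<phi> = id \<or> \<phi> = quadc"
  shows "commutator Aut_shift shift_bot (add_bot \<phi>) (join u v) = join u (v \<boxplus> diffc (\<phi> u))"
proof -
  have "commutator Aut_shift shift_bot (add_bot \<phi>) (join u v) =
      join u (shift ((\<lambda>i. (v \<boxplus> \<phi> u) (i - 1)) \<boxplus> \<phi> u))"
    by (subst group.commutator_involution(1)[OF group_Aut_shift shift_gates_Aut_shift(3) add_involution(2)[OF assms]])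
      (simp add: inv_shift_gates, simp add: gate_defs)
  also have "shift ((\<lambda>i. (v \<boxplus> \<phi> u) (i - 1)) \<boxplus> \<phi> u) = v \<boxplus> diffc (\<phi> u)"
    by (auto simp: shift_def addc_def diffc_def)
  finally show ?thesis .
qed

section \<open>The centralizer of the gates\<close>

lemma locally_determined_join:
  assumes "locally_determined g"
  shows "locally_determined (\<lambda>u. g (join u v))" "locally_determined (\<lambda>v. g (join u v))"
proof -
  show "locally_determined (\<lambda>u. g (join u v))"
    unfolding locally_determined_def
  proof
    fix u
    obtain N where N: "\<And>y. (\<And>j. \<bar>j\<bar> \<le> N \<Longrightarrow> y j = join u v j) \<Longrightarrow> g y = g (join u v)"
      using assms locally_determinedE[of g "join u v"] by metis
    show "\<exists>N. \<forall>y. (\<forall>j. \<bar>j\<bar> \<le> N \<longrightarrow> y j = u j) \<longrightarrow> g (join y v) = g (join u v)"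
      by (intro exI[of _ N] allI impI N) (simp add: join_def)
  qed
  show "locally_determined (\<lambda>v. g (join u v))"
    unfolding locally_determined_def
  proof
    fix v
    obtain N where N: "\<And>y. (\<And>j. \<bar>j\<bar> \<le> N \<Longrightarrow> y j = join u v j) \<Longrightarrow> g y = g (join u v)"
      using assms locally_determinedE[of g "join u v"] by metis
    show "\<exists>N. \<forall>y. (\<forall>j. \<bar>j\<bar> \<le> N \<longrightarrow> y j = v j) \<longrightarrow> g (join u y) = g (join u v)"
      by (intro exI[of _ N] allI impI N) (simp add: join_def)
  qed
qed

lemma product_if_commutes_with_swap_gate:
  assumes f: "f \<in> carrier Aut_shift"
    and comm: "\<And>x. f (commutator Aut_shift shift_top swap x) = commutator Aut_shift shift_top swap (f x)"
  obtains E F where "\<And>u v. f (join u v) = join (E u) (F v)"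
proof -
  have f_shift: "f (shift x) = shift (f x)" for x
    using f by (simp add: fun_eq_iff)
  have top: "locally_determined (\<lambda>x. top_track (f x) i)"
    and bot: "locally_determined (\<lambda>x. bot_track (f x) i)" for i
    unfolding top_track_def bot_track_def
    by (rule locally_determined_map[OF Aut_shift_locally_determined[OF f]])+
  have gate: "commutator Aut_shift shift_top swap x =
      join (shift (top_track x)) (\<lambda>i. bot_track x (i - 1))" for x
    using gate_swap[of "top_track x" "bot_track x"] by simp
  have shift2: "(\<lambda>i. u (i + int 2)) = shift (shift u)" for u :: "bool config"
    by (simp add: shift_def add.commute)
  \<comment> \<open>Following the swap gate by \<open>shift\<close> cancels the motion of the bottom
    track and moves the top track by two. Hence the bottom output is invariant when the top input
    moves by two.\<close>
  have bot_inv: "bot_track (f (join (shift (shift u)) v)) = bot_track (f (join u v))" for u v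
  proof -
    have "join (shift (shift u)) v = shift (commutator Aut_shift shift_top swap (join u v))"
      by (simp add: gate_swap) (simp add: shift_def)
    then have "f (join (shift (shift u)) v) = shift (commutator Aut_shift shift_top swap (f (join u v)))"
      by (simp only: f_shift comm)
    then show ?thesis
      by (simp add: gate) (simp add: shift_def)
  qed
  have "bot_track (f (join u v)) i = bot_track (f (join u' v)) i" for u u' v i
    by (rule translation_invariant_constant[of "\<lambda>u. bot_track (f (join u v)) i" 2,
          OF locally_determined_join(1)[OF bot]]) (simp_all only: shift2 bot_inv zero_less_numeral)
  then have bot_eq: "bot_track (f (join u v)) = bot_track (f (join (\<lambda>_. False) v))" for u v
    by blast
  \<comment> \<open>Dually, the gate sends the input with bottom track moved by two to
    \<open>shift (join u v)\<close>. Comparing top outputs leaves one common shift to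
    cancel.\<close>
  have top_inv: "top_track (f (join u (shift (shift v)))) = top_track (f (join u v))" for u v
  proof -
    have "commutator Aut_shift shift_top swap (join u (shift (shift v))) = shift (join u v)"
      by (simp add: gate_swap) (simp add: shift_def add.commute)
    then have "shift (top_track (f (join u (shift (shift v))))) = shift (top_track (f (join u v)))"
      using comm[of "join u (shift (shift v))"] by (simp only: f_shift gate) (metis top_join top_shift)
    from fun_cong[OF this, of "i - 1" for i] show ?thesis
      by (simp add: shift_def fun_eq_iff)
  qed
  have "top_track (f (join u v)) i = top_track (f (join u v')) i" for u v v' i
    by (rule translation_invariant_constant[of "\<lambda>v. top_track (f (join u v)) i" 2,
          OF locally_determined_join(2)[OF top]]) (simp_all only: shift2 top_inv zero_less_numeral)
  then have "top_track (f (join u v)) = top_track (f (join u (\<lambda>_. False)))" for u v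
    by blast
  with bot_eq show thesis
    by (intro that[of "\<lambda>u. top_track (f (join u (\<lambda>_. False)))" "\<lambda>v. bot_track (f (join (\<lambda>_. False) v))"])
      (metis join_tracks)
qed

lemma centralizer_gates:
  assumes f: "f \<in> carrier Aut_shift"
    and comm: "\<And>g x. g \<in> gates \<Longrightarrow> f (g x) = g (f x)"
  obtains n where "f = shift [^]\<^bsub>Aut_shift\<^esub> (n::int)"
proof -
  obtain E F where EF: "\<And>u v. f (join u v) = join (E u) (F v)"
    using product_if_commutes_with_swap_gate[OF f] comm unfolding gates_def by blast
  have "f (shift (join u v)) = shift (f (join u v))" for u v
    using f by (simp add: fun_eq_iff del: shift_join)
  then have sh: "E (shift u) = shift (E u)" "F (shift v) = shift (F v)" for u v
    by (simp_all add: EF)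
  have E_ld: "locally_determined (\<lambda>u. E u i)" and F_ld: "locally_determined (\<lambda>u. F u i)" for i
  proof -
    have "locally_determined (\<lambda>x. top_track (f x) i)" "locally_determined (\<lambda>x. bot_track (f x) i)"
      unfolding top_track_def bot_track_def
      by (rule locally_determined_map[OF Aut_shift_locally_determined[OF f]])+
    from locally_determined_join(1)[OF this(1)] locally_determined_join(2)[OF this(2)]
    show "locally_determined (\<lambda>u. E u i)" "locally_determined (\<lambda>u. F u i)"
      by (simp_all add: EF)
  qed
  have "inj E"
    using Aut_shift_inj[OF f] EF by (metis injD injI join_eq_iff)
  have gate: "commutator Aut_shift shift_top (add_top id) \<in> gates"
      "commutator Aut_shift shift_top (add_top quadc) \<in> gates"
      "commutator Aut_shift shift_bot (add_bot quadc) \<in> gates"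
    by (auto simp: gates_def)
  have lin: "E (u \<boxplus> diffc v) = E u \<boxplus> diffc (F v)" for u v
    using comm[OF gate(1), of "join u v"] by (simp add: gate_add_top EF)
  have quad: "E (u \<boxplus> diffc (quadc v)) = E u \<boxplus> diffc (quadc (F v))" for u v
    using comm[OF gate(2), of "join u v"] by (simp add: gate_add_top EF)
  have quad': "F (v \<boxplus> diffc (quadc u)) = F v \<boxplus> diffc (quadc (E u))" for u v
    using comm[OF gate(3), of "join u v"] by (simp add: gate_add_bot EF)
  obtain n c where nc: "\<And>u i. E u i = (u (i + n) \<noteq> c)" "\<And>u i. F u i = u (i + n)"
    using translate_up_to_flip[OF E_ld F_ld sh \<open>inj E\<close> lin quad] by blast
  have E_n: "E u i = u (i + n)" for u i
    using translate_if_quadratic[OF nc quad'] nc(2) by simp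
  have "f x = (shift [^]\<^bsub>Aut_shift\<^esub> n) x" for x
  proof -
    \<comment> \<open>Both tracks move by the same \<open>n\<close>, so rejoining them yields a
      translation of the whole configuration.\<close>
    have "E u = (\<lambda>i. u (i + n))" "F u = (\<lambda>i. u (i + n))" for u
      by (simp_all add: E_n nc(2) fun_eq_iff)
    then have "f x = join (\<lambda>i. top_track x (i + n)) (\<lambda>i. bot_track x (i + n))"
      using EF[of "top_track x" "bot_track x"] by simp
    also have "\<dots> = (\<lambda>i. join (top_track x) (bot_track x) (i + n))"
      by (simp only: join_def)
    finally show ?thesis
      by (simp add: shift_int_pow)
  qed
  then show thesis
    using that by blast
qed

end

theorem theorem7p16:
  defines "G \<equiv> (Aut_shift :: (4 config \<Rightarrow> 4 config) monoid)"
  shows "\<exists>F. finite F \<and> F \<subseteq> carrier G \<and>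
    (\<forall>g\<in>F. \<exists>a\<in>carrier G. \<exists>b\<in>carrier G. g = commutator G a b) \<and>
    (\<forall>g\<in>F. \<exists>ts. set ts \<subseteq> involutions G \<and> g = foldr (\<otimes>\<^bsub>G\<^esub>) ts \<one>\<^bsub>G\<^esub>) \<and>
    (\<forall>f\<in>carrier G. (\<forall>g\<in>F. f \<otimes>\<^bsub>G\<^esub> g = g \<otimes>\<^bsub>G\<^esub> f) \<longrightarrow> f \<in> {shift [^]\<^bsub>G\<^esub> n | n :: int. True})"
proof -
  \<comment> \<open>Both types have four elements; any bijection serves as the coding by two
    bits.\<close>
  have "\<exists>enc :: 4 \<Rightarrow> bool \<times> bool. bij enc"
    by (rule finite_same_card_bij) simp_all
  then obtain enc :: "4 \<Rightarrow> bool \<times> bool" where "bij enc" ..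
  then interpret two_tracks enc
    by unfold_locales
  interpret G: group G
    unfolding G_def by (rule group_Aut_shift)
  have form: "\<exists>a\<in>carrier G. \<exists>s\<in>involutions G. g = commutator G a s" if "g \<in> gates" for g
    using gates_form[OF that] by (simp only: G_def)
  have carrier: "involutions G \<subseteq> carrier G"
    by (auto simp: involutions_def)
  show ?thesis
  proof (intro exI[of _ gates] conjI ballI impI subsetI)
    show "finite gates"
      by (simp add: gates_def)
  next
    fix g assume "g \<in> gates"
    then obtain a s where as: "a \<in> carrier G" "s \<in> involutions G" and g: "g = commutator G a s"
      using form by blast
    show "\<exists>a\<in>carrier G. \<exists>b\<in>carrier G. g = commutator G a b"
      using as g carrier by blast
    show "g \<in> carrier G"
      using as g carrier by (auto simp: commutator_def)
    \<comment> \<open>The commutator as a word of length two: the conjugate of \<open>s\<close>,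
      then \<open>s\<close> itself.\<close>
    have "g = foldr (\<otimes>\<^bsub>G\<^esub>) [a \<otimes>\<^bsub>G\<^esub> s \<otimes>\<^bsub>G\<^esub> inv\<^bsub>G\<^esub> a, s] \<one>\<^bsub>G\<^esub>"
      using as carrier by (auto simp: g G.commutator_involution(1))
    then show "\<exists>ts. set ts \<subseteq> involutions G \<and> g = foldr (\<otimes>\<^bsub>G\<^esub>) ts \<one>\<^bsub>G\<^esub>"
      using as G.commutator_involution(2)[OF as] by (intro exI[of _ "[a \<otimes>\<^bsub>G\<^esub> s \<otimes>\<^bsub>G\<^esub> inv\<^bsub>G\<^esub> a, s]"]) auto
  next
    fix f assume "f \<in> carrier G" and "\<forall>g\<in>gates. f \<otimes>\<^bsub>G\<^esub> g = g \<otimes>\<^bsub>G\<^esub> f"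
    then have "\<And>g x. g \<in> gates \<Longrightarrow> f (g x) = g (f x)"
      by (simp add: G_def fun_eq_iff)
    then show "f \<in> {shift [^]\<^bsub>G\<^esub> n | n :: int. True}"
      using centralizer_gates[of f] \<open>f \<in> carrier G\<close> unfolding G_def by blast
  qed
qed

end
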